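(* Let $G$ be a finitely generated abelian group (written multiplicatively), let $\lambda:G\times G\to\mathbb{K}$ satisfy $\lambda(y,x)=-\lambda(x,y)$ and $\lambda(x,yz)=\lambda(x,y)+\lambda(x,z)$ for all $x,y,z\in G$, and let $\mathbb{K}_P^\lambda[G]$ be the corresponding Poisson group algebra. Then every Poisson derivation of $\mathbb{K}_P^\lambda[G]$ is uniquely the sum of an inner Poisson derivation and a central Poisson derivation.
   Context: $\mathbb{K}$ is a field of characteristic zero. The Poisson group algebra $\mathbb{K}_P^\lambda[G]$ is the commutative $\mathbb{K}$-algebra with basis $\{\bar g\mid g\in G\}$, product $\bar x\bar y=\overline{xy}$, and Poisson bracket $\{\bar x,\bar y\}=\lambda(x,y)\bar x\bar y$ for $x,y\in G$. Put $C:=\{g\in G\mid\{\bar g,\bar x\}=0\text{ for all }x\in G\}$, a subgroup of $G$, and let $\mathbb{K}_P^\lambda[C]$ be the span of $\{\bar g\mid g\in C\}$. A Poisson derivation is a $\mathbb{K}$-linear map $\mathcal{D}$ with $\mathcal{D}(ab)=\mathcal{D}(a)b+a\mathcal{D}(b)$ and $\mathcal{D}(\{a,b\})=\{\mathcal{D}(a),b\}+\{a,\mathcal{D}(b)\}$. An inner Poisson derivation is a map $\mathrm{ham}_\gamma=\{\gamma,-\}$ with $\gamma\in\mathbb{K}_P^\lambda[G]$. A central Poisson derivation is a $\mathbb{K}$-linear map $\mathcal{D}_\theta$ given by $\mathcal{D}_\theta(\bar x)=\theta(x)\bar x$ for $x\in G$, where $\theta:(G,\cdot)\to(\mathbb{K}_P^\lambda[C],+)$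 is a group homomorphism (it is also called a scalar Poisson derivation when the Poisson centre of $\mathbb{K}_P^\lambda[G]$ is $\mathbb{K}$). *)

theory Defs
  imports
    Complex_Main
    "HOL-Library.Poly_Mapping"
    "HOL-Computational_Algebra.Group_Closure"
begin

text \<open>
  The abelian group \<open>G\<close> is a type of class \<open>ab_group_add\<close>, so it is written additively.
  The group algebra is the type of finitely supported functions
  \<open>'g \<Rightarrow>\<^sub>0 'k\<close>, whose library product is convolution, i.e. the bilinear extension of
  \<open>single x 1 * single y 1 = single (x + y) 1\<close>.
\<close>

definition finitely_generated_group :: "'g::ab_group_add itself \<Rightarrow> bool" where
  "finitely_generated_group _ \<longleftrightarrow> (\<exists>S :: 'g set. finite S \<and> group_closure S = UNIV)"

abbreviation gbasis :: "'g \<Rightarrow> 'g \<Rightarrow>\<^sub>0 'k::field_char_0" where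
  "gbasis x \<equiv> Poly_Mapping.single x 1"

definition gscale :: "'k::field_char_0 \<Rightarrow> ('g \<Rightarrow>\<^sub>0 'k) \<Rightarrow> 'g \<Rightarrow>\<^sub>0 'k" where
  "gscale c a = Poly_Mapping.map ((*) c) a"

lemma lookup_gscale [simp]: "Poly_Mapping.lookup (gscale c a) x = c * Poly_Mapping.lookup a x"
  by (simp add: gscale_def map.rep_eq when_def in_keys_iff)

lemma gscale_conv_mult:
  "gscale c a = Poly_Mapping.single 0 c * (a :: 'g::ab_group_add \<Rightarrow>\<^sub>0 'k::field_char_0)"
  unfolding gscale_def by (rule mult_map_scale_conv_mult)

lemma vector_space_gscale:
  "vector_space (gscale :: 'k::field_char_0 \<Rightarrow> ('g \<Rightarrow>\<^sub>0 'k) \<Rightarrow> 'g \<Rightarrow>\<^sub>0 'k)"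
  by unfold_locales (auto intro!: poly_mapping_eqI simp: lookup_add algebra_simps)

text \<open>The bilinear extension of \<open>{gbasis x, gbasis y} = \<lambda>(x,y) gbasis x gbasis y\<close>.\<close>

definition poisson_bracket ::
  "('g::ab_group_add \<Rightarrow> 'g \<Rightarrow> 'k::field_char_0) \<Rightarrow> ('g \<Rightarrow>\<^sub>0 'k) \<Rightarrow> ('g \<Rightarrow>\<^sub>0 'k) \<Rightarrow> ('g \<Rightarrow>\<^sub>0 'k)"
  where
  "poisson_bracket lam a b =
     (\<Sum>x\<in>Poly_Mapping.keys a. \<Sum>y\<in>Poly_Mapping.keys b.
        gscale (Poly_Mapping.lookup a x * Poly_Mapping.lookup b y) (gscale (lam x y) (gbasis x * gbasis y)))"

lemma poisson_bracket_gbasis: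
  "poisson_bracket lam (gbasis x) (gbasis y) = gscale (lam x y) (gbasis x * gbasis y)"
  by (rule poly_mapping_eqI) (simp add: poisson_bracket_def)

lemma poisson_bracket_superset:
  assumes "finite A" "Poly_Mapping.keys a \<subseteq> A" "finite B" "Poly_Mapping.keys b \<subseteq> B"
  shows "poisson_bracket lam a b =
    (\<Sum>x\<in>A. \<Sum>y\<in>B. gscale (Poly_Mapping.lookup a x * Poly_Mapping.lookup b y) (gscale (lam x y) (gbasis x * gbasis y)))"
proof -
  have z: "gscale 0 c = 0" for c :: "'g \<Rightarrow>\<^sub>0 'b"
    by (rule poly_mapping_eqI) simp
  have "poisson_bracket lam a b =
      (\<Sum>x\<in>Poly_Mapping.keys a. \<Sum>y\<in>B.
        gscale (Poly_Mapping.lookup a x * Poly_Mapping.lookup b y) (gscale (lam x y) (gbasis x * gbasis y)))"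
    unfolding poisson_bracket_def using assms
    by (intro sum.cong refl sum.mono_neutral_left) (auto simp: in_keys_iff z)
  also have "\<dots> = (\<Sum>x\<in>A. \<Sum>y\<in>B.
        gscale (Poly_Mapping.lookup a x * Poly_Mapping.lookup b y) (gscale (lam x y) (gbasis x * gbasis y)))"
    using assms by (intro sum.mono_neutral_left) (auto simp: in_keys_iff z)
  finally show ?thesis .
qed

lemma linear_poisson_bracket_left:
  "Vector_Spaces.linear gscale gscale (\<lambda>a. poisson_bracket lam a b)"
proof -
  have "poisson_bracket lam (a + a') b = poisson_bracket lam a b + poisson_bracket lam a' b"
    for a a'
  proof -
    let ?A = "Poly_Mapping.keys a \<union> Poly_Mapping.keys a' \<union> Poly_Mapping.keys (a + a')"
    note * = poisson_bracket_superset[of ?A _ "Poly_Mapping.keys b" b lam]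
    show ?thesis
      by (subst (1 2 3) *; auto simp: lookup_add lookup_sum algebra_simps sum.distrib
          intro!: poly_mapping_eqI)
  qed
  moreover have "poisson_bracket lam (gscale c a) b = gscale c (poisson_bracket lam a b)" for c a
  proof -
    let ?A = "Poly_Mapping.keys a \<union> Poly_Mapping.keys (gscale c a)"
    note * = poisson_bracket_superset[of ?A _ "Poly_Mapping.keys b" b lam]
    show ?thesis
      by (subst (1 2) *; auto simp: lookup_sum algebra_simps sum_distrib_left
          intro!: poly_mapping_eqI)
  qed
  ultimately show ?thesis
    using vector_space_gscale by (auto simp: Vector_Spaces.linear_iff)
qed

lemma linear_poisson_bracket_right:
  "Vector_Spaces.linear gscale gscale (\<lambda>b. poisson_bracket lam a b)"
proof -
  have "poisson_bracket lam a (b + b') = poisson_bracket lam a b + poisson_bracket lam a b'"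
    for b b'
  proof -
    let ?B = "Poly_Mapping.keys b \<union> Poly_Mapping.keys b' \<union> Poly_Mapping.keys (b + b')"
    note * = poisson_bracket_superset[of "Poly_Mapping.keys a" a ?B _ lam]
    show ?thesis
      by (subst (1 2 3) *; auto simp: lookup_add lookup_sum algebra_simps sum.distrib
          intro!: poly_mapping_eqI)
  qed
  moreover have "poisson_bracket lam a (gscale c b) = gscale c (poisson_bracket lam a b)" for c b
  proof -
    let ?B = "Poly_Mapping.keys b \<union> Poly_Mapping.keys (gscale c b)"
    note * = poisson_bracket_superset[of "Poly_Mapping.keys a" a ?B _ lam]
    show ?thesis
      by (subst (1 2) *; auto simp: lookup_sum algebra_simps sum_distrib_left
          intro!: poly_mapping_eqI)
  qed
  ultimately show ?thesis
    using vector_space_gscale by (auto simp: Vector_Spaces.linear_iff)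
qed

definition bracket_central :: "('g::ab_group_add \<Rightarrow> 'g \<Rightarrow> 'k::field_char_0) \<Rightarrow> 'g set" where
  "bracket_central lam = {g. \<forall>x. poisson_bracket lam (gbasis g) (gbasis x) = 0}"

definition central_subalgebra ::
  "('g::ab_group_add \<Rightarrow> 'g \<Rightarrow> 'k::field_char_0) \<Rightarrow> ('g \<Rightarrow>\<^sub>0 'k) set" where
  "central_subalgebra lam = module.span gscale (gbasis ` bracket_central lam)"

definition poisson_derivation ::
  "('g::ab_group_add \<Rightarrow> 'g \<Rightarrow> 'k::field_char_0) \<Rightarrow> (('g \<Rightarrow>\<^sub>0 'k) \<Rightarrow> ('g \<Rightarrow>\<^sub>0 'k)) \<Rightarrow> bool" where
  "poisson_derivation lam D \<longleftrightarrow>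
     Vector_Spaces.linear gscale gscale D \<and>
     (\<forall>a b. D (a * b) = D a * b + a * D b) \<and>
     (\<forall>a b. D (poisson_bracket lam a b) =
        poisson_bracket lam (D a) b + poisson_bracket lam a (D b))"

definition inner_poisson_derivation ::
  "('g::ab_group_add \<Rightarrow> 'g \<Rightarrow> 'k::field_char_0) \<Rightarrow> (('g \<Rightarrow>\<^sub>0 'k) \<Rightarrow> ('g \<Rightarrow>\<^sub>0 'k)) \<Rightarrow> bool" where
  "inner_poisson_derivation lam D \<longleftrightarrow> (\<exists>c. D = (\<lambda>a. poisson_bracket lam c a))"

definition central_poisson_derivation ::
  "('g::ab_group_add \<Rightarrow> 'g \<Rightarrow> 'k::field_char_0) \<Rightarrow> (('g \<Rightarrow>\<^sub>0 'k) \<Rightarrow> ('g \<Rightarrow>\<^sub>0 'k)) \<Rightarrow> bool" where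
  "central_poisson_derivation lam D \<longleftrightarrow>
     Vector_Spaces.linear gscale gscale D \<and>
     (\<exists>\<theta>. additive \<theta> \<and> (\<forall>x. \<theta> x \<in> central_subalgebra lam) \<and>
        (\<forall>x. D (gbasis x) = \<theta> x * gbasis x))"

end

theory Submission
  imports Defs
begin

text \<open>
  The proof compares coefficients. Every linear map \<open>D\<close> is determined by the numbers
  \<open>f\<^sub>g(x)\<close>, the coefficient of \<open>g + x\<close> in \<open>D\<close> of the basis element \<open>x\<close>; so \<open>D\<close> splits into its
  \<open>G\<close>-homogeneous components. If \<open>D\<close> is a Poisson derivation, the product rule says that each
  \<open>f\<^sub>g\<close> is additive (\<open>coeff_additive\<close>), and the bracket rule then says that
  \<open>f\<^sub>g(x) \<lambda>(g,y) = f\<^sub>g(y) \<lambda>(g,x)\<close> (\<open>coeff_proportional\<close>). If \<open>g \<notin> C\<close>, some \<open>\<lambda>(g,y)\<close> is nonzero,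
  so \<open>f\<^sub>g\<close> is a scalar multiple \<open>c\<^sub>g \<lambda>(g,\<cdot>)\<close>: the component of \<open>D\<close> in degree \<open>g\<close> is the bracket with
  \<open>c\<^sub>g g\<close>. The components of degree \<open>g \<in> C\<close> assemble to a central derivation.

  Finite generation makes \<open>\<gamma> = \<Sum> c\<^sub>g g\<close> a finite sum: an additive \<open>f\<^sub>g\<close> that is
  nonzero is nonzero on one of the finitely many generators \<open>s\<close>, so that \<open>g + s\<close> lies in the finite
  support of \<open>D(s)\<close> (\<open>finite_coeff_support\<close>).

  Uniqueness holds because an inner derivation has components only in degrees outside \<open>C\<close>
  and a central derivation only in degrees inside \<open>C\<close>: the inner part of \<open>D\<close> consists of the
  components of \<open>D\<close> in the degrees outside \<open>C\<close>.
\<close>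

section \<open>Coefficients\<close>

lemma lookup_times_gbasis:
  fixes a :: "'g::ab_group_add \<Rightarrow>\<^sub>0 'k::field_char_0"
  shows "Poly_Mapping.lookup (a * gbasis y) (g + y) = Poly_Mapping.lookup a g"
proof (induction a rule: update_induct)
  case const
  then show ?case by simp
next
  case (update f a b)
  have "Poly_Mapping.update a b f = f + Poly_Mapping.single a b"
    using update
    by (intro poly_mapping_eqI) (auto simp: lookup_add lookup_update lookup_single when_def in_keys_iff)
  then show ?case
    using update by (simp add: distrib_right mult_single lookup_add lookup_single)
qed

lemma lookup_gbasis_times:
  fixes a :: "'g::ab_group_add \<Rightarrow>\<^sub>0 'k::field_char_0"
  shows "Poly_Mapping.lookup (gbasis y * a) (y + g) = Poly_Mapping.lookup a g"
  using lookup_times_gbasis[of a y g] by (simp add: ac_simps)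

lemma lookup_poisson_bracket_gbasis_right:
  "Poly_Mapping.lookup (poisson_bracket lam c (gbasis x)) (g + x)
     = Poly_Mapping.lookup c g * lam g x"
  by (auto simp: poisson_bracket_def lookup_sum mult_single lookup_single when_def in_keys_iff
      if_distrib[of "(*) _"] cong: if_cong)

lemma lookup_poisson_bracket_gbasis_left:
  "Poly_Mapping.lookup (poisson_bracket lam (gbasis x) c) (x + g)
     = Poly_Mapping.lookup c g * lam x g"
  by (auto simp: poisson_bracket_def lookup_sum mult_single lookup_single when_def in_keys_iff
      if_distrib[of "(*) _"] cong: if_cong)

lemma bracket_central_iff: "g \<in> bracket_central lam \<longleftrightarrow> (\<forall>x. lam g x = 0)"
proof -
  have "gscale (lam g x) (gbasis g * gbasis x) = 0 \<longleftrightarrow> lam g x = 0" for x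
    by (auto simp: poly_mapping_eq_iff fun_eq_iff mult_single lookup_single when_def)
  then show ?thesis
    by (simp add: bracket_central_def poisson_bracket_gbasis)
qed

lemma sum_gscale_gbasis:
  assumes "finite A" "Poly_Mapping.keys a \<subseteq> A"
  shows "(\<Sum>x\<in>A. gscale (Poly_Mapping.lookup a x) (gbasis x)) = a"
  using assms
  by (intro poly_mapping_eqI)
    (auto simp: lookup_sum lookup_single when_def in_keys_iff if_distrib[of "(*) _"] cong: if_cong)

lemma central_subalgebra_iff:
  "a \<in> central_subalgebra lam \<longleftrightarrow> Poly_Mapping.keys a \<subseteq> bracket_central lam"
proof -
  interpret vector_space "gscale :: 'k::field_char_0 \<Rightarrow> ('g::ab_group_add \<Rightarrow>\<^sub>0 'k) \<Rightarrow> 'g \<Rightarrow>\<^sub>0 'k"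
    by (rule vector_space_gscale)
  show ?thesis
  proof
    assume "a \<in> central_subalgebra lam"
    then have "a \<in> span (gbasis ` bracket_central lam)"
      by (simp add: central_subalgebra_def)
    then show "Poly_Mapping.keys a \<subseteq> bracket_central lam"
    proof (induction rule: span_induct_alt)
      case base
      then show ?case by simp
    next
      case (step c x y)
      then show ?case
        by (auto simp: in_keys_iff lookup_add lookup_single when_def subset_iff split: if_splits)
    qed
  next
    assume *: "Poly_Mapping.keys a \<subseteq> bracket_central lam"
    have "(\<Sum>x\<in>Poly_Mapping.keys a. gscale (Poly_Mapping.lookup a x) (gbasis x))
        \<in> central_subalgebra lam"
      unfolding central_subalgebra_def
      by (intro span_sum span_scale span_base) (use * in auto)
    then show "a \<in> central_subalgebra lam"
      by (simp add: sum_gscale_gbasis)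
  qed
qed

lemma linear_eq_on_gbasis:
  fixes F F' :: "('g \<Rightarrow>\<^sub>0 'k::field_char_0) \<Rightarrow> ('h \<Rightarrow>\<^sub>0 'k)"
  assumes "Vector_Spaces.linear gscale gscale F" "Vector_Spaces.linear gscale gscale F'"
    and "\<And>x. F (gbasis x) = F' (gbasis x)"
  shows "F = F'"
proof
  fix a :: "'g \<Rightarrow>\<^sub>0 'k"
  interpret F: Vector_Spaces.linear gscale gscale F by (rule assms)
  interpret F': Vector_Spaces.linear gscale gscale F' by (rule assms)
  let ?s = "\<Sum>x\<in>Poly_Mapping.keys a. gscale (Poly_Mapping.lookup a x) (gbasis x)"
  have "F ?s = F' ?s"
    by (simp add: F.sum F'.sum F.scale F'.scale assms(3))
  then show "F a = F' a"
    by (simp add: sum_gscale_gbasis)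
qed

section \<open>Homogeneous components of a Poisson derivation\<close>

text \<open>The coefficient \<open>f\<^sub>g(x)\<close> of the introduction.\<close>

definition shift_coeff ::
  "(('g::ab_group_add \<Rightarrow>\<^sub>0 'k::field_char_0) \<Rightarrow> ('g \<Rightarrow>\<^sub>0 'k)) \<Rightarrow> 'g \<Rightarrow> 'g \<Rightarrow> 'k" where
  "shift_coeff D g x = Poly_Mapping.lookup (D (gbasis x)) (g + x)"

lemma linear_eqI_shift_coeff:
  assumes "Vector_Spaces.linear gscale gscale F" "Vector_Spaces.linear gscale gscale F'"
    and "\<And>g x. shift_coeff F g x = shift_coeff F' g x"
  shows "F = F'"
proof (rule linear_eq_on_gbasis[OF assms(1,2)])
  fix x
  have "Poly_Mapping.lookup (F (gbasis x)) h = Poly_Mapping.lookup (F' (gbasis x)) h" for h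
    using assms(3)[of "h - x" x] by (simp add: shift_coeff_def)
  then show "F (gbasis x) = F' (gbasis x)"
    by (rule poly_mapping_eqI)
qed

lemma shift_coeff_bracket: "shift_coeff (poisson_bracket lam c) g x = Poly_Mapping.lookup c g * lam g x"
  by (simp add: shift_coeff_def lookup_poisson_bracket_gbasis_right)

lemma coeff_additive:
  assumes "poisson_derivation lam D"
  shows "additive (shift_coeff D g)"
proof
  fix x y
  have "D (gbasis x * gbasis y) = D (gbasis x) * gbasis y + gbasis x * D (gbasis y)"
    using assms by (simp only: poisson_derivation_def)
  then have "D (gbasis (x + y)) = D (gbasis x) * gbasis y + gbasis x * D (gbasis y)"
    by (simp add: mult_single)
  then show "shift_coeff D g (x + y) = shift_coeff D g x + shift_coeff D g y"
    using lookup_times_gbasis[of "D (gbasis x)" y "g + x"]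
      lookup_gbasis_times[of x "D (gbasis y)" "g + y"]
    by (simp add: shift_coeff_def lookup_add ac_simps)
qed

text \<open>Comparing the coefficients of \<open>g + x + y\<close> in the bracket rule for the basis elements \<open>x\<close> and
  \<open>y\<close>, all terms with \<open>\<lambda>(x,y)\<close> cancel by additivity of \<open>f\<^sub>g\<close>; what is left are the terms in which
  \<open>\<lambda>\<close> sees \<open>g\<close>.\<close>

lemma coeff_proportional:
  assumes skew: "\<And>x y. lam y x = - lam x y"
    and add: "\<And>x y z. lam x (y + z) = lam x y + lam x z"
    and D: "poisson_derivation lam D"
  shows "shift_coeff D g x * lam g y = shift_coeff D g y * lam g x"
proof -
  interpret D: Vector_Spaces.linear gscale gscale D
    using D by (simp add: poisson_derivation_def)
  have "D (poisson_bracket lam (gbasis x) (gbasis y))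
      = poisson_bracket lam (D (gbasis x)) (gbasis y)
      + poisson_bracket lam (gbasis x) (D (gbasis y))"
    using D by (simp only: poisson_derivation_def)
  then have "gscale (lam x y) (D (gbasis (x + y)))
      = poisson_bracket lam (D (gbasis x)) (gbasis y)
      + poisson_bracket lam (gbasis x) (D (gbasis y))"
    by (simp add: poisson_bracket_gbasis mult_single D.scale)
  from arg_cong[OF this, of "\<lambda>a. Poly_Mapping.lookup a (g + (x + y))"]
  have "lam x y * shift_coeff D g (x + y)
      = shift_coeff D g x * lam (g + x) y + shift_coeff D g y * lam x (g + y)"
    using lookup_poisson_bracket_gbasis_right[of lam "D (gbasis x)" y "g + x"]
      lookup_poisson_bracket_gbasis_left[of lam x "D (gbasis y)" "g + y"]
    by (simp add: shift_coeff_def lookup_add ac_simps)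
  moreover have "shift_coeff D g (x + y) = shift_coeff D g x + shift_coeff D g y"
    using coeff_additive[OF D] by (rule additive.add)
  moreover have "lam (g + x) y = lam g y + lam x y"
    using skew[of "g + x" y] skew[of g y] skew[of x y] add[of y g x] by simp
  moreover have "lam x (g + y) = - lam g x + lam x y"
    using add skew[of x g] by simp
  ultimately show ?thesis
    by (simp add: algebra_simps)
qed

lemma additive_eq_zero_on_group_closure:
  assumes "additive f" "\<And>s. s \<in> S \<Longrightarrow> f s = 0" "x \<in> group_closure S"
  shows "f x = 0"
  using assms(3)
  by induction (use assms(2) additive.zero[OF assms(1)] additive.diff[OF assms(1)] in auto)

text \<open>An additive function vanishes once it vanishes on generators, so a degree \<open>g\<close> that occurs in
  \<open>D\<close> already occurs in \<open>D(s)\<close> for some generator \<open>s\<close>.\<close>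

lemma finite_coeff_support:
  fixes D :: "('g::ab_group_add \<Rightarrow>\<^sub>0 'k::field_char_0) \<Rightarrow> ('g \<Rightarrow>\<^sub>0 'k)"
  assumes "finitely_generated_group TYPE('g)" and D: "poisson_derivation lam D"
  shows "finite {g. \<exists>x. shift_coeff D g x \<noteq> 0}"
proof -
  obtain S :: "'g set" where S: "finite S" "group_closure S = UNIV"
    using assms(1) by (auto simp: finitely_generated_group_def)
  have "{g. \<exists>x. shift_coeff D g x \<noteq> 0}
      \<subseteq> (\<Union>s\<in>S. (\<lambda>h. h - s) ` Poly_Mapping.keys (D (gbasis s)))"
  proof
    fix g assume "g \<in> {g. \<exists>x. shift_coeff D g x \<noteq> 0}"
    then obtain s where "s \<in> S" "shift_coeff D g s \<noteq> 0"
      using additive_eq_zero_on_group_closure[OF coeff_additive[OF D]] S(2) by blast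
    then have "g + s \<in> Poly_Mapping.keys (D (gbasis s))" "g = (g + s) - s"
      by (auto simp: shift_coeff_def in_keys_iff)
    with \<open>s \<in> S\<close>
    show "g \<in> (\<Union>s\<in>S. (\<lambda>h. h - s) ` Poly_Mapping.keys (D (gbasis s)))"
      by blast
  qed
  then show ?thesis
    by (rule finite_subset) (use S(1) in auto)
qed

text \<open>The sum of the components of \<open>D\<close> in the degrees outside \<open>C\<close> is inner: since \<open>f\<^sub>g\<close> and
  \<open>\<lambda>(g,\<cdot>)\<close> are proportional, \<open>f\<^sub>g = c\<^sub>g \<lambda>(g,\<cdot>)\<close> with \<open>c\<^sub>g = f\<^sub>g(y) / \<lambda>(g,y)\<close> for any \<open>y\<close> that makes
  the denominator nonzero.\<close>

lemma exists_hamiltonian: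
  fixes lam :: "'g::ab_group_add \<Rightarrow> 'g \<Rightarrow> 'k::field_char_0"
  assumes "finitely_generated_group TYPE('g)"
    and "\<And>x y. lam y x = - lam x y"
    and "\<And>x y z. lam x (y + z) = lam x y + lam x z"
    and "poisson_derivation lam D"
  obtains c where
    "\<And>g x. g \<notin> bracket_central lam \<Longrightarrow> shift_coeff D g x = shift_coeff (poisson_bracket lam c) g x"
proof -
  \<comment> \<open>For \<open>g \<in> C\<close> the witness is arbitrary and the quotient is a division by zero, so \<open>c\<close> has the
    coefficient 0 there.\<close>
  define w where "w g = (SOME y. lam g y \<noteq> 0)" for g
  define c where "c = Abs_poly_mapping (\<lambda>g. shift_coeff D g (w g) / lam g (w g))"
  have "finite {g. shift_coeff D g (w g) / lam g (w g) \<noteq> 0}"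
    by (rule finite_subset[OF _ finite_coeff_support[OF assms(1,4)]]) auto
  then have lookup_c: "Poly_Mapping.lookup c g = shift_coeff D g (w g) / lam g (w g)" for g
    by (simp add: c_def)
  show thesis
  proof
    fix g x assume "g \<notin> bracket_central lam"
    then have "lam g (w g) \<noteq> 0"
      unfolding w_def by (rule_tac someI_ex) (auto simp: bracket_central_iff)
    then show "shift_coeff D g x = shift_coeff (poisson_bracket lam c) g x"
      using coeff_proportional[OF assms(2-4), of g x "w g"]
      by (simp add: shift_coeff_bracket lookup_c field_simps)
  qed
qed

section \<open>Inner and central derivations by their components\<close>

lemma shift_coeff_inner_eq_zero:
  assumes "inner_poisson_derivation lam I" "g \<in> bracket_central lam"
  shows "shift_coeff I g x = 0"
  using assms by (auto simp: inner_poisson_derivation_def shift_coeff_bracket bracket_central_iff)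

text \<open>The coefficient of \<open>\<theta>(x)\<close> at \<open>g\<close> is the coefficient of \<open>\<theta>(x) x\<close> at \<open>g + x\<close>. So \<open>\<theta>\<close> is additive
  if and only if every component is, and its values lie in the span of \<open>C\<close> if and only if the
  components in the degrees outside \<open>C\<close> vanish.\<close>

lemma central_poisson_derivation_iff:
  fixes lam :: "'g::ab_group_add \<Rightarrow> 'g \<Rightarrow> 'k::field_char_0"
  shows "central_poisson_derivation lam Z \<longleftrightarrow> Vector_Spaces.linear gscale gscale Z \<and>
    (\<forall>g. additive (shift_coeff Z g)) \<and>
    (\<forall>g x. g \<notin> bracket_central lam \<longrightarrow> shift_coeff Z g x = 0)"
    (is "?central \<longleftrightarrow> ?linear \<and> ?additive \<and> ?vanishing")
proof
  assume ?central
  then obtain \<theta> where \<theta>: ?linear "additive \<theta>" "\<And>x. \<theta> x \<in> central_subalgebra lam"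
      "\<And>x. Z (gbasis x) = \<theta> x * gbasis x"
    by (auto simp: central_poisson_derivation_def)
  have coeff: "shift_coeff Z g x = Poly_Mapping.lookup (\<theta> x) g" for g x
    by (simp add: shift_coeff_def \<theta>(4) lookup_times_gbasis)
  have ?vanishing
    using \<theta>(3) unfolding coeff central_subalgebra_iff in_keys_iff subset_iff by blast
  then show "?linear \<and> ?additive \<and> ?vanishing"
    using \<theta>(1,2) by (simp add: additive_def coeff lookup_add)
next
  assume *: "?linear \<and> ?additive \<and> ?vanishing"
  \<comment> \<open>The basis elements are units, so \<open>\<theta>\<close> can be recovered from \<open>Z\<close>.\<close>
  define \<theta> where "\<theta> x = Z (gbasis x) * gbasis (- x)" for x
  have lookup_\<theta>: "Poly_Mapping.lookup (\<theta> x) g = shift_coeff Z g x" for x g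
    using lookup_times_gbasis[of "Z (gbasis x)" "- x" "g + x"]
    by (simp add: \<theta>_def shift_coeff_def)
  have "additive \<theta>"
    using * by (auto intro!: poly_mapping_eqI simp: additive_def lookup_add lookup_\<theta>)
  moreover have "\<theta> x \<in> central_subalgebra lam" for x
    using * by (auto simp: central_subalgebra_iff in_keys_iff lookup_\<theta>)
  moreover have "Z (gbasis x) = \<theta> x * gbasis x" for x
    by (simp add: \<theta>_def mult.assoc mult_single)
  ultimately show ?central
    using * by (auto simp: central_poisson_derivation_def)
qed

lemma inner_poisson_derivation_linear:
  assumes "inner_poisson_derivation lam I"
  shows "Vector_Spaces.linear gscale gscale I"
  using assms linear_poisson_bracket_right by (auto simp: inner_poisson_derivation_def)

section \<open>The decomposition\<close>

theorem theorem2p6: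
  fixes lam :: "'g::ab_group_add \<Rightarrow> 'g \<Rightarrow> 'k::field_char_0"
    and D :: "('g \<Rightarrow>\<^sub>0 'k) \<Rightarrow> ('g \<Rightarrow>\<^sub>0 'k)"
  assumes "finitely_generated_group TYPE('g)"
    and "\<And>x y. lam y x = - lam x y"
    and "\<And>x y z. lam x (y + z) = lam x y + lam x z"
    and "poisson_derivation lam D"
  shows "\<exists>!(I, Z). inner_poisson_derivation lam I \<and> central_poisson_derivation lam Z \<and>
           D = (\<lambda>a. I a + Z a)"
proof -
  obtain c where c: "\<And>g x. g \<notin> bracket_central lam \<Longrightarrow>
      shift_coeff D g x = shift_coeff (poisson_bracket lam c) g x"
    using exists_hamiltonian[OF assms] by metis
  define I where "I = poisson_bracket lam c"
  define Z where "Z = (\<lambda>a. D a - I a)"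
  have inner: "inner_poisson_derivation lam I"
    by (auto simp: inner_poisson_derivation_def I_def)
  have "Vector_Spaces.linear gscale gscale D"
    using assms(4) by (simp add: poisson_derivation_def)
  then have "Vector_Spaces.linear gscale gscale Z"
    using inner_poisson_derivation_linear[OF inner]
    by (auto simp: Z_def Vector_Spaces.linear_iff algebra_simps
        module.scale_right_diff_distrib[OF vector_space_gscale[folded module_iff_vector_space]])
  moreover have coeff_Z: "shift_coeff Z g x = shift_coeff D g x - shift_coeff I g x" for g x
    by (simp add: shift_coeff_def Z_def lookup_minus)
  moreover have "additive (shift_coeff Z g)" for g
    using coeff_additive[OF assms(4), of g] assms(3)
    by (simp add: additive_def coeff_Z I_def shift_coeff_bracket algebra_simps)
  ultimately have central: "central_poisson_derivation lam Z"
    using c by (auto simp: central_poisson_derivation_iff I_def)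
  show ?thesis
  proof (rule ex1I[of _ "(I, Z)"])
    show "case (I, Z) of (I, Z) \<Rightarrow> inner_poisson_derivation lam I \<and>
        central_poisson_derivation lam Z \<and> D = (\<lambda>a. I a + Z a)"
      using inner central by (simp add: Z_def)
  next
    fix p assume *: "case p of (I, Z) \<Rightarrow> inner_poisson_derivation lam I \<and>
        central_poisson_derivation lam Z \<and> D = (\<lambda>a. I a + Z a)"
    obtain I' Z' where p: "p = (I', Z')" by fastforce
    then have inner': "inner_poisson_derivation lam I'"
      and central': "central_poisson_derivation lam Z'"
      and D': "D = (\<lambda>a. I' a + Z' a)"
      using * by auto
    have "I' = I"
    proof (rule linear_eqI_shift_coeff)
      fix g x
      \<comment> \<open>In a degree outside \<open>C\<close> the central part contributes nothing, so there the component of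
        either inner part is that of \<open>D\<close>.\<close>
      show "shift_coeff I' g x = shift_coeff I g x"
      proof (cases "g \<in> bracket_central lam")
        case True
        then show ?thesis
          using shift_coeff_inner_eq_zero inner inner' by metis
      next
        case False
        have "shift_coeff D g x = shift_coeff I' g x + shift_coeff Z' g x"
          by (simp add: D' shift_coeff_def lookup_add)
        with False show ?thesis
          using c central' by (simp add: central_poisson_derivation_iff I_def)
      qed
    qed (rule inner_poisson_derivation_linear inner inner')+
    then show "p = (I, Z)"
      by (simp add: p Z_def D')
  qed
qed

end
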